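(* Let $V$ be a vector space of finite dimension $n$ over a field $\mathbb K$. (a) If $n=5$, then $R^\uparrow(H)\neq\emptyset$ for every hyperplane $H$ of $\mathcal G_3(V)$ and any choice of the field $\mathbb K$. (b) If $n=6$, then there exists a hyperplane $H$ of $\mathcal G_3(V)$ such that $R^\uparrow(H)$ is a line-spread of $\mathrm{PG}(V)$ if and only if $\mathbb K$ is not quadratically closed.
   Context: For $1\le k<n=\dim V$, $\mathcal G_k(V)$ is the point-line geometry whose points are the $k$-dimensional subspaces of $V$ and whose lines are the sets $\{X : Y\subset X\subset Z,\ \dim X=k\}$ with $Y\subset Z$ subspaces of $V$, $\dim Y=k-1$, $\dim Z=k+1$. A subspace of $\mathcal G_k(V)$ is a set $S$ of points containing every line that meets $S$ in at least two points; a hyperplane of $\mathcal G_k(V)$ is a proper subspace meeting every line non-trivially. It is known (Shult) that the hyperplanes of $\mathcal G_k(V)$ are exactly the sets of $k$-subspaces of $V$ on which a given non-trivial alternating $k$-linear form $\varphi$ on $V$ identically vanishes, $\varphi$ being unique up to a non-zero scalar. The upper radical $R^\uparrow(H)$ of a hyperplane $H$ of $\mathcal G_3(V)$ is the set of $2$-dimensional subspaces $A$ of $V$ such that every $3$-dimensional subspace of $V$ containing $A$ belongs to $H$. It is a (line-)spread of $\mathrm{PG}(V)$ if every $1$-dimensional subspace of $V$ is contained in exactly one member of $R^\uparrow(H)$. A field $\mathbb K$ is quadratically closed if there is no irreducible polynomial of degree $2$ in $\mathbb K[t]$ (equivalently, $\mathbb K$ has no quadratic extension, separable or not). *)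

theory Defs
  imports "HOL-Computational_Algebra.Polynomial"
begin

text \<open>A point-line geometry is given by its set of points and its set of lines,
  each line being a set of points.\<close>

definition geometry_subspace :: "'p set \<Rightarrow> 'p set set \<Rightarrow> 'p set \<Rightarrow> bool" where
  "geometry_subspace P L S \<longleftrightarrow>
     S \<subseteq> P \<and> (\<forall>l\<in>L. (\<exists>x\<in>l \<inter> S. \<exists>y\<in>l \<inter> S. x \<noteq> y) \<longrightarrow> l \<subseteq> S)"

definition geometry_hyperplane :: "'p set \<Rightarrow> 'p set set \<Rightarrow> 'p set \<Rightarrow> bool" where
  "geometry_hyperplane P L H \<longleftrightarrow>
     geometry_subspace P L H \<and> H \<noteq> P \<and> (\<forall>l\<in>L. l \<inter> H \<noteq> {})"

text \<open>The library's dimension is 0 for spaces without a finite basis, so prescribing a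
  positive dimension forces finite dimension.\<close>

definition subspaces_of_dim ::
  "('a::field \<Rightarrow> 'v::ab_group_add \<Rightarrow> 'v) \<Rightarrow> nat \<Rightarrow> 'v set set" where
  "subspaces_of_dim scale k = {X. module.subspace scale X \<and> vector_space.dim scale X = k}"

text \<open>The Grassmann geometry has point set \<open>subspaces_of_dim scale k\<close>; its definition is meant
  for \<open>1 \<le> k\<close>.\<close>

definition grassmann_lines ::
  "('a::field \<Rightarrow> 'v::ab_group_add \<Rightarrow> 'v) \<Rightarrow> nat \<Rightarrow> 'v set set set" where
  "grassmann_lines scale k =
     {{X \<in> subspaces_of_dim scale k. Y \<subseteq> X \<and> X \<subseteq> Z} | Y Z.
        Y \<in> subspaces_of_dim scale (k - 1) \<and> Z \<in> subspaces_of_dim scale (k + 1) \<and> Y \<subseteq> Z}"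

definition grassmann_hyperplane ::
  "('a::field \<Rightarrow> 'v::ab_group_add \<Rightarrow> 'v) \<Rightarrow> nat \<Rightarrow> 'v set set \<Rightarrow> bool" where
  "grassmann_hyperplane scale k H \<longleftrightarrow>
     geometry_hyperplane (subspaces_of_dim scale k) (grassmann_lines scale k) H"

definition upper_radical ::
  "('a::field \<Rightarrow> 'v::ab_group_add \<Rightarrow> 'v) \<Rightarrow> 'v set set \<Rightarrow> 'v set set" where
  "upper_radical scale H =
     {A \<in> subspaces_of_dim scale 2. \<forall>X \<in> subspaces_of_dim scale 3. A \<subseteq> X \<longrightarrow> X \<in> H}"

definition line_spread ::
  "('a::field \<Rightarrow> 'v::ab_group_add \<Rightarrow> 'v) \<Rightarrow> 'v set set \<Rightarrow> bool" where
  "line_spread scale S \<longleftrightarrow>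
     S \<subseteq> subspaces_of_dim scale 2 \<and>
     (\<forall>p \<in> subspaces_of_dim scale 1. \<exists>!A. A \<in> S \<and> p \<subseteq> A)"

definition quadratically_closed :: "'a::field itself \<Rightarrow> bool" where
  "quadratically_closed _ \<longleftrightarrow> \<not> (\<exists>p :: 'a poly. degree p = 2 \<and> irreducible p)"

end

theory Submission
  imports Defs "HOL-Computational_Algebra.Polynomial_Factorial"
begin

text \<open>
  A hyperplane of \<open>\<G>\<^sub>3(V)\<close> is the zero set of an alternating trilinear form, but the proof does not
  construct that form. It works with the ternary relation \<open>h x y z\<close>, ``\<open>x, y, z\<close> are dependent or
  span a member of \<open>H\<close>'', which behaves like the equation \<open>\<phi>(x,y,z) = 0\<close>: it is invariant under
  permutations, it holds when two arguments agree, and for fixed \<open>x, y\<close> its solutions \<open>z\<close> form a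
  subspace that every line of \<open>PG(V)\<close> meets. The locale \<open>alternating_zero_relation\<close> collects these
  properties. The line spanned by \<open>x\<close> and \<open>y\<close> is in the upper radical iff \<open>h x y z\<close> holds for all
  \<open>z\<close>, and the upper radical is a spread iff every radical \<open>rad x = {y. \<forall>z. h x y z}\<close> with
  \<open>x \<noteq> 0\<close> has dimension two.

  Dimension five. The zeros of \<open>h x y\<close> have dimension at least four, so they contain independent
  vectors \<open>x, y, z, w\<close>. Some \<open>p \<noteq> 0\<close> in \<open>\<langle>x, y\<rangle>\<close> satisfies \<open>h p z w\<close>, which makes \<open>h p\<close> vanish
  identically on \<open>\<langle>x, y, z, w\<rangle>\<close>; a vector \<open>v \<noteq> 0\<close> in \<open>\<langle>z, w\<rangle>\<close> with \<open>h p v e\<close> for one further \<open>e\<close>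
  then gives a line \<open>\<langle>p, v\<rangle>\<close> of the upper radical.

  Dimension six, from a spread to the field. Choose spread lines \<open>A, B, C\<close> with \<open>V = A \<oplus> B \<oplus> C\<close>. If
  two of the vectors \<open>a \<in> A\<close>, \<open>b \<in> B\<close>, \<open>c \<in> C\<close> are non-zero and fixed, then \<open>h a b c\<close> determines the
  third one up to scalars (\<open>not_all_zero_on_rad\<close>). So each \<open>a \<noteq> 0\<close> pairs the points of \<open>B\<close> with those
  of \<open>C\<close>. Although no form is available, the alternating property forces this correspondence to come
  from a linear isomorphism \<open>B \<rightarrow> C\<close> (\<open>linear_conjugate_map\<close>). Two independent vectors of \<open>A\<close> give two
  isomorphisms. If \<open>\<K>\<close> is quadratically closed, one of them followed by the inverse of the other has
  an eigenvector \<open>b\<close>; with its common partner \<open>c\<close> it satisfies \<open>h a b c\<close> for every \<open>a\<close> in \<open>A\<close>, which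
  contradicts the uniqueness of \<open>a\<close>.

  Dimension six, from the field to a spread. For an irreducible quadratic \<open>p\<close> identify \<open>V\<close> with \<open>L\<^sup>3\<close>,
  where \<open>L = \<K>[t]/(p)\<close>, and compose the \<open>3 \<times> 3\<close> determinant over \<open>L\<close> with a non-zero \<open>\<K>\<close>-linear
  functional on \<open>L\<close>. The upper radical of the resulting hyperplane consists of the one-dimensional
  \<open>L\<close>-subspaces, which partition the non-zero vectors.
\<close>

section \<open>Alternating zero relations\<close>

context vector_space
begin

lemma combination_notin_span:
  assumes "x \<notin> span A" "y \<notin> span (insert x A)" "s \<noteq> 0 \<or> t \<noteq> 0"
  shows "scale s x + scale t y \<notin> span A"
proof
  assume *: "scale s x + scale t y \<in> span A"
  show False
  proof (cases "t = 0")
    case True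
    with * have "scale s x \<in> span A" by simp
    then have "scale (inverse s) (scale s x) \<in> span A"
      by (rule span_scale)
    with True assms show False by simp
  next
    case False
    have "scale s x + scale t y \<in> span (insert x A)"
      using * span_mono[of A "insert x A"] by blast
    then have "(scale s x + scale t y) - scale s x \<in> span (insert x A)"
      by (rule span_diff[OF _ span_scale[OF span_base]]) simp
    then have "scale t y \<in> span (insert x A)" by simp
    then have "scale (inverse t) (scale t y) \<in> span (insert x A)"
      by (rule span_scale)
    with False assms show False by simp
  qed
qed

end

text \<open>The last axiom is the trace of trilinearity that replaces the form: it says that the subspace of the
axiom before it has codimension at most one.\<close>

locale alternating_zero_relation = finite_dimensional_vector_space scale Basis
  for scale :: "'a::field \<Rightarrow> 'v::ab_group_add \<Rightarrow> 'v" and Basis +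
  fixes h :: "'v \<Rightarrow> 'v \<Rightarrow> 'v \<Rightarrow> bool"
  assumes h_swap12: "h x y z \<Longrightarrow> h y x z"
    and h_swap23: "h x y z \<Longrightarrow> h x z y"
    and h_same12: "h x x z"
    and subspace_h: "subspace {z. h x y z}"
    and h_meets_line: "\<exists>s t. (s \<noteq> 0 \<or> t \<noteq> 0) \<and> h x y (scale s u + scale t v)"
begin

lemma h_swap13: "h x y z \<Longrightarrow> h z y x"
  using h_swap12 h_swap23 by blast

lemma h_same: "h x x z" "h x z x" "h z x x"
  using h_same12 h_swap12 h_swap23 by blast+

lemma h_zero: "h x y 0" "h x 0 y" "h 0 x y"
  using subspace_0[OF subspace_h[of x y]] h_swap12 h_swap23 by blast+

lemma h_add:
  "h x y u \<Longrightarrow> h x y v \<Longrightarrow> h x y (u + v)"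
  "h x u z \<Longrightarrow> h x v z \<Longrightarrow> h x (u + v) z"
  "h u y z \<Longrightarrow> h v y z \<Longrightarrow> h (u + v) y z"
proof -
  have *: "h x y u \<Longrightarrow> h x y v \<Longrightarrow> h x y (u + v)" for x y u v
    using subspace_add[OF subspace_h[of x y]] by blast
  show
    "h x y u \<Longrightarrow> h x y v \<Longrightarrow> h x y (u + v)"
    "h x u z \<Longrightarrow> h x v z \<Longrightarrow> h x (u + v) z"
    "h u y z \<Longrightarrow> h v y z \<Longrightarrow> h (u + v) y z"
    using * h_swap13 h_swap23 by blast+
qed

lemma h_scale:
  "h x y z \<Longrightarrow> h x y (scale c z)"
  "h x y z \<Longrightarrow> h x (scale c y) z"
  "h x y z \<Longrightarrow> h (scale c x) y z"
proof -
  have *: "h x y z \<Longrightarrow> h x y (scale c z)" for x y z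
    using subspace_scale[OF subspace_h[of x y]] by blast
  show
  "h x y z \<Longrightarrow> h x y (scale c z)"
  "h x y z \<Longrightarrow> h x (scale c y) z"
  "h x y z \<Longrightarrow> h (scale c x) y z"
    using * h_swap13 h_swap23 by blast+
qed

lemma h_diff:
  "h x y u \<Longrightarrow> h x y v \<Longrightarrow> h x y (u - v)"
  "h x u z \<Longrightarrow> h x v z \<Longrightarrow> h x (u - v) z"
proof -
  have *: "h x y u \<Longrightarrow> h x y v \<Longrightarrow> h x y (u - v)" for x y u v
    using subspace_diff[OF subspace_h[of x y]] by blast
  show
  "h x y u \<Longrightarrow> h x y v \<Longrightarrow> h x y (u - v)"
  "h x u z \<Longrightarrow> h x v z \<Longrightarrow> h x (u - v) z"
    using * h_swap23 by blast+
qed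

lemma h_unscale:
  assumes "c \<noteq> 0"
  shows "h x y (scale c z) \<longleftrightarrow> h x y z" "h x (scale c y) z \<longleftrightarrow> h x y z" "h (scale c x) y z \<longleftrightarrow> h x y z"
proof -
  have *: "h x y (scale c z) \<longleftrightarrow> h x y z" for x y z
  proof
    assume "h x y (scale c z)"
    from h_scale(1)[OF this, of "inverse c"] assms show "h x y z" by simp
  qed (rule h_scale)
  show "h x y (scale c z) \<longleftrightarrow> h x y z" "h x (scale c y) z \<longleftrightarrow> h x y z" "h (scale c x) y z \<longleftrightarrow> h x y z"
    using * h_swap13 h_swap23 by blast+
qed

lemma h_span:
  assumes "z \<in> span S" "\<And>s. s \<in> S \<Longrightarrow> h x y s"
  shows "h x y z"
  using span_minimal[OF _ subspace_h, of S x y] assms by auto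

lemma h_span3:
  assumes "\<And>x y z. x \<in> A \<Longrightarrow> y \<in> A \<Longrightarrow> z \<in> A \<Longrightarrow> h x y z"
    and "x \<in> span A" "y \<in> span A" "z \<in> span A"
  shows "h x y z"
proof -
  have 1: "h x y z" if "x \<in> A" "y \<in> A" for x y
    using h_span[OF assms(4)] assms(1) that by blast
  have 2: "h x y z" if "x \<in> A" for x
    using h_swap23[OF h_span[OF assms(3)]] h_swap23[OF 1] that by blast
  show ?thesis
    using h_swap13[OF h_span[OF assms(2)]] h_swap13[OF 2] by blast
qed

text \<open>A subspace that meets every two-dimensional space is all of \<open>V\<close> or is complemented by any single
vector outside it.\<close>

lemma dim_zeros: "dim (UNIV::'v set) \<le> Suc (dim {z. h x y z})"
proof (cases "\<forall>z. h x y z")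
  case True
  then show ?thesis by simp
next
  case False
  then obtain u where u: "\<not> h x y u" by blast
  have "v \<in> span (insert u {z. h x y z})" for v
  proof -
    obtain s t where st: "s \<noteq> 0 \<or> t \<noteq> 0" "h x y (scale s u + scale t v)"
      using h_meets_line by blast
    have "t \<noteq> 0"
      using st u h_unscale(1)[of s x y u] by auto
    have "(scale s u + scale t v) - scale s u \<in> span (insert u {z. h x y z})"
      using st by (intro span_diff span_scale span_base) auto
    then have "scale t v \<in> span (insert u {z. h x y z})" by simp
    then have "scale (inverse t) (scale t v) \<in> span (insert u {z. h x y z})"
      by (rule span_scale)
    with \<open>t \<noteq> 0\<close> show ?thesis by simp
  qed
  then have "UNIV \<subseteq> span (insert u {z. h x y z})" by blast
  then have "dim (UNIV::'v set) \<le> dim (insert u {z. h x y z})" by (rule dim_mono)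
  also have "\<dots> \<le> Suc (dim {z. h x y z})" by (simp add: dim_insert)
  finally show ?thesis .
qed

lemma obtain_outside:
  assumes "dim S < dim T"
  obtains z where "z \<in> T" "z \<notin> span S"
  using dim_mono[of T S] assms by force

section \<open>A radical line in dimension five\<close>

lemma exists_radical_pair_dim5:
  assumes dim5: "dim (UNIV::'v set) = 5"
  shows "\<exists>x y. x \<noteq> 0 \<and> y \<notin> span {x} \<and> (\<forall>z. h x y z)"
proof -
  obtain x where x: "x \<notin> span {}"
    using obtain_outside[of "{}" UNIV] dim5 by auto
  obtain y where y: "y \<notin> span {x}"
    using obtain_outside[of "{x}" UNIV] x dim5 by auto
  have d2: "dim {y, x} = 2" using x y by (simp add: dim_insert)
  have K: "4 \<le> dim {z. h x y z}" using dim_zeros[of x y] dim5 by simp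
  obtain z where z: "h x y z" "z \<notin> span {y, x}"
    using obtain_outside[of "{y, x}" "{z. h x y z}"] d2 K by auto
  have d3: "dim {z, y, x} = 3" using d2 z by (simp add: dim_insert)
  obtain w where w: "h x y w" "w \<notin> span {z, y, x}"
    using obtain_outside[of "{z, y, x}" "{z. h x y z}"] d3 K by auto
  have d4: "dim {w, z, y, x} = 4" using d3 w by (simp add: dim_insert[of w])
  obtain e where e: "e \<notin> span {w, z, y, x}"
    using obtain_outside[of "{w, z, y, x}" UNIV] d4 dim5 by auto
  have "dim {e, w, z, y, x} = 5" using d4 e by (simp add: dim_insert[of e])
  then have full: "span {e, w, z, y, x} = UNIV"
    using dim_eq_full dim5 by (simp add: dimension_def)
  \<comment> \<open>On the span of \<open>x, y, z, w\<close> only the triples \<open>x, z, w\<close> and \<open>y, z, w\<close> can fail, and \<open>p\<close> kills the right combination of them.\<close>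
  obtain s t where st: "s \<noteq> 0 \<or> t \<noteq> 0" "h z w (scale s x + scale t y)"
    using h_meets_line by blast
  define p where "p = scale s x + scale t y"
  have p: "p \<noteq> 0" "p \<in> span {y, x}"
    using combination_notin_span[OF x y st(1)] span_zero
    by (auto simp: p_def simp del: span_empty intro: span_add[OF span_scale span_scale] span_base)
  \<comment> \<open>As \<open>h p\<close> vanishes on that span, any \<open>v\<close> in it needs only one more condition, towards \<open>e\<close>.\<close>
  obtain a b where ab: "a \<noteq> 0 \<or> b \<noteq> 0" "h p e (scale a z + scale b w)"
    using h_meets_line by blast
  define v where "v = scale a z + scale b w"
  have "v \<notin> span {y, x}"
    using combination_notin_span[OF z(2) w(2) ab(1)] by (simp add: v_def)
  moreover have "span {p} \<subseteq> span {y, x}"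
    using p by (simp add: span_minimal)
  ultimately have v: "v \<notin> span {p}" by blast
  have xyv: "h x y v" unfolding v_def using z w by (intro h_add h_scale)
  have "h p v x" unfolding p_def using xyv
    by (intro h_add h_scale) (auto intro: h_same h_swap12 h_swap23 h_swap13)
  moreover have "h p v y" unfolding p_def using xyv
    by (intro h_add h_scale) (auto intro: h_same h_swap12 h_swap23 h_swap13)
  moreover have zwp: "h p z w" using st(2) h_swap13 h_swap23 p_def by blast
  have "h p v z" unfolding v_def using zwp
    by (intro h_add h_scale) (auto intro: h_same h_swap12 h_swap23 h_swap13)
  moreover have "h p v w" unfolding v_def using zwp
    by (intro h_add h_scale) (auto intro: h_same h_swap12 h_swap23 h_swap13)
  moreover have "h p v e" using ab v_def h_swap23 by blast
  ultimately have "h p v u" for u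
    using h_span[of u "{e, w, z, y, x}" p v] full by auto
  then show ?thesis using p v by blast
qed

section \<open>Radicals that form a spread\<close>

definition rad :: "'v \<Rightarrow> 'v set" where
  "rad x = {y. \<forall>z. h x y z}"

lemma rad_sym: "y \<in> rad x \<Longrightarrow> x \<in> rad y"
  unfolding rad_def using h_swap12 by blast

lemma self_in_rad: "x \<in> rad x"
  unfolding rad_def using h_same by blast

lemma subspace_rad: "subspace (rad x)"
  by (rule subspaceI) (auto simp: rad_def h_zero h_add h_scale)

lemma rad_scale: "c \<noteq> 0 \<Longrightarrow> rad (scale c x) = rad x"
  by (simp add: rad_def h_unscale)

end

locale spread_zero_relation = alternating_zero_relation scale Basis h
  for scale :: "'a::field \<Rightarrow> 'v::ab_group_add \<Rightarrow> 'v" and Basis h +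
  assumes rad_line: "x \<noteq> 0 \<Longrightarrow> \<exists>y. y \<notin> span {x} \<and> rad x = span {y, x}"
begin

lemma dim_rad: "x \<noteq> 0 \<Longrightarrow> dim (rad x) = 2"
  using rad_line[of x] by (force simp: dim_insert)

lemma rad_eq:
  assumes "x \<noteq> 0" "y \<noteq> 0" "y \<in> rad x"
  shows "rad y = rad x"
proof (cases "y \<in> span {x}")
  case True
  then obtain c where "y = scale c x" by (auto simp: span_singleton)
  with assms show ?thesis by (auto simp: rad_scale)
next
  case False
  have d: "dim (span {y, x}) = 2" using False assms by (simp add: dim_insert)
  have "span {y, x} \<subseteq> rad x" "span {y, x} \<subseteq> rad y"
    using assms(3) rad_sym[OF assms(3)] self_in_rad by (simp_all add: span_minimal subspace_rad)
  then have "span {y, x} = rad x" "span {y, x} = rad y"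
    using subspace_dim_equal[of "span {y,x}"] dim_rad assms(1,2) d subspace_rad subspace_span
    by (metis order_refl)+
  then show ?thesis by simp
qed

lemma rad_disjoint:
  assumes "x \<noteq> 0" "y \<noteq> 0" "y \<notin> rad x" "v \<in> rad x" "v \<in> rad y"
  shows "v = 0"
  using rad_eq[of x v] rad_eq[of y v] assms self_in_rad[of y] by auto

text \<open>If \<open>h x b z\<close> held for all \<open>b \<in> rad y\<close>, then every \<open>b \<in> rad y\<close> would satisfy \<open>h x b u\<close> for all \<open>u\<close> in the
five-dimensional span of \<open>rad x\<close>, \<open>rad y\<close> and \<open>z\<close>. For a vector \<open>w\<close> outside that span one can choose \<open>v \<noteq> 0\<close> in \<open>rad y\<close> with \<open>h x w v\<close>, and this puts \<open>v\<close> into \<open>rad x \<inter> rad y\<close>.\<close>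

lemma not_all_zero_on_rad:
  assumes dim6: "dim (UNIV::'v set) = 6"
    and "x \<noteq> 0" "y \<noteq> 0" "y \<notin> rad x" "z \<notin> span (rad x \<union> rad y)"
  shows "\<exists>b\<in>rad y. \<not> h x b z"
proof (rule ccontr)
  assume "\<not> ?thesis"
  then have all: "h x b z" if "b \<in> rad y" for b using that by blast
  obtain x' where x': "x' \<notin> span {x}" "rad x = span {x', x}" using rad_line assms by blast
  obtain y' where y': "y' \<notin> span {y}" "rad y = span {y', y}" using rad_line assms by blast
  have in_y: "y \<in> rad y" "y' \<in> rad y" using y' by (auto simp: span_base)
  have sp: "span (rad x \<union> rad y) = span {y', y, x', x}"
  proof
    show "span (rad x \<union> rad y) \<subseteq> span {y', y, x', x}"
      unfolding x' y' by (intro span_minimal Un_least subspace_span) (auto simp: span_base)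
    show "span {y', y, x', x} \<subseteq> span (rad x \<union> rad y)"
      unfolding x' y' by (intro span_mono) (auto simp: span_base)
  qed
  have d2: "dim {x', x} = 2" using x' assms by (simp add: dim_insert)
  have d3: "dim {y, x', x} = 3" using d2 x' assms by (simp add: dim_insert[of y])
  have "y' \<notin> span {y, x', x}"
  proof
    assume "y' \<in> span {y, x', x}"
    then obtain k where k: "y' - scale k y \<in> span {x', x}"
      unfolding span_insert[of y] by blast
    moreover have "y' - scale k y \<in> rad y"
      using in_y subspace_rad by (intro subspace_diff subspace_scale)
    ultimately have "y' - scale k y = 0"
      using rad_disjoint[of x y "y' - scale k y"] assms x'(2) by simp
    then show False using y'(1) by (auto simp: span_singleton)
  qed
  then have d4: "dim {y', y, x', x} = 4" using d3 by (simp add: dim_insert[of y'])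
  have d5: "dim {z, y', y, x', x} = 5" using d4 assms(5) sp by (simp add: dim_insert[of z])
  obtain w where w: "w \<notin> span {z, y', y, x', x}"
    using obtain_outside[of "{z, y', y, x', x}" UNIV] d5 dim6 by auto
  have "dim {w, z, y', y, x', x} = 6" using d5 w by (simp add: dim_insert[of w])
  then have full: "span {w, z, y', y, x', x} = UNIV"
    using dim_eq_full dim6 by (simp add: dimension_def)
  obtain s t where st: "s \<noteq> 0 \<or> t \<noteq> 0" "h x w (scale s y + scale t y')"
    using h_meets_line by blast
  define v where "v = scale s y + scale t y'"
  have v: "v \<noteq> 0" "v \<in> rad y"
    using combination_notin_span[of y "{}" y' s t] assms(3) y'(1) st(1)
    by (simp_all add: v_def in_y subspace_rad subspace_add subspace_scale)
  have "h x v x" by (rule h_same)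
  moreover have "x' \<in> rad x" using x' by (simp add: span_base)
  then have "h x v x'" using h_swap23 unfolding rad_def by blast
  moreover have "y \<in> rad v" "y' \<in> rad v"
    using v rad_eq[of y v] assms in_y by auto
  then have "h x v y" "h x v y'"
    using h_swap12 h_swap13 h_swap23 unfolding rad_def by blast+
  moreover have "h x v z" using all v by blast
  moreover have "h x v w" using st v_def h_swap23 by blast
  ultimately have "h x v u" for u
    using h_span[of u "{w, z, y', y, x', x}" x v] full by auto
  then have "v \<in> rad x" unfolding rad_def by blast
  then show False using rad_disjoint[of x y v] v assms by blast
qed

end

context alternating_zero_relation
begin

text \<open>Fix \<open>a\<close> and call \<open>u, v\<close> orthogonal if \<open>h a u v\<close>. Between two totally isotropic lines that
it pairs non-degenerately, orthogonality is a bijection of points; this lemma says that it is induced by a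
linear map. Let \<open>d0\<close> and \<open>e\<close> be the partners of \<open>b0\<close> and \<open>b1\<close>. The vector \<open>b0 + d0\<close> is orthogonal to
some \<open>e + k b1\<close>. With \<open>u = b0 + t b1 + d0\<close> and \<open>w = u - (t / k) (e + k b1)\<close>, the \<open>b1\<close>-part of \<open>w\<close>
cancels, so \<open>w\<close> is orthogonal to \<open>d0\<close>; it is orthogonal to \<open>u\<close> because \<open>u\<close> is orthogonal to itself.
Hence \<open>b0 + t b1 = u - d0\<close> is orthogonal to \<open>w\<close>, and so to \<open>d0 - (t / k) e\<close>, which is linear in \<open>t\<close>.\<close>

lemma linear_conjugate_map:
  assumes bb: "h a b0 b1"
    and c: "c \<noteq> 0" "c' \<notin> span {c}"
    and cc: "h a c c'"
    and nondeg: "\<And>v. v \<in> span {c', c} \<Longrightarrow> v \<noteq> 0 \<Longrightarrow> \<not> (h a b0 v \<and> h a b1 v)"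
  obtains d0 d1 where "d0 \<in> span {c', c}" "d1 \<in> span {c', c}" "d0 \<noteq> 0" "d1 \<notin> span {d0}"
    "\<And>s t. h a (scale s b0 + scale t b1) (scale s d0 + scale t d1)"
proof -
  have in_C: "scale s c + scale t c' \<in> span {c', c}" for s t
    by (intro span_add span_scale) (auto intro: span_base)
  have nz: "scale s c + scale t c' \<noteq> 0" if "s \<noteq> 0 \<or> t \<noteq> 0" for s t
    using combination_notin_span[of c "{}" c' s t] c that by simp
  have CC: "h a u v" if "u \<in> span {c', c}" "v \<in> span {c', c}" for u v
  proof -
    have "h a c v" "h a c' v"
      using h_span[OF that(2), of a c] h_span[OF that(2), of a c'] cc h_same h_swap23 by blast+
    then show ?thesis
      using h_span[OF that(1), of a v] h_swap23 by blast
  qed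
  obtain s0 t0 where 0: "s0 \<noteq> 0 \<or> t0 \<noteq> 0" "h a b0 (scale s0 c + scale t0 c')"
    using h_meets_line by blast
  obtain s1 t1 where 1: "s1 \<noteq> 0 \<or> t1 \<noteq> 0" "h a b1 (scale s1 c + scale t1 c')"
    using h_meets_line by blast
  define d0 where "d0 = scale s0 c + scale t0 c'"
  define e where "e = scale s1 c + scale t1 c'"
  have d0: "d0 \<in> span {c', c}" "d0 \<noteq> 0" "h a b0 d0" using 0 in_C nz by (auto simp: d0_def)
  have e: "e \<in> span {c', c}" "e \<noteq> 0" "h a b1 e" using 1 in_C nz by (auto simp: e_def)
  have e_ind: "e \<notin> span {d0}"
  proof
    assume "e \<in> span {d0}"
    then obtain k where "e = scale k d0" by (auto simp: span_singleton)
    with d0(3) have "h a b0 e" by (simp add: h_scale)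
    then show False using nondeg e by blast
  qed
  obtain p q where pq: "p \<noteq> 0 \<or> q \<noteq> 0" "h a (b0 + d0) (scale p e + scale q b1)"
    using h_meets_line by blast
  have "p \<noteq> 0"
  proof
    assume "p = 0"
    with pq have "h a (b0 + d0) b1" by (simp add: h_unscale)
    from h_diff(2)[OF this bb] have "h a b1 d0" by (simp add: h_swap23)
    then show False using nondeg d0 by blast
  qed
  define k where "k = q / p"
  have y: "h a (b0 + d0) (e + scale k b1)"
  proof -
    have "scale p (e + scale k b1) = scale p e + scale q b1"
      using \<open>p \<noteq> 0\<close> by (simp add: k_def scale_right_distrib)
    with pq(2) show ?thesis using h_unscale(1)[OF \<open>p \<noteq> 0\<close>] by metis
  qed
  have "k \<noteq> 0"
  proof
    assume "k = 0"
    with y have "h a (b0 + d0) e" by simp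
    from h_diff(2)[OF this CC[OF d0(1) e(1)]] have "h a b0 e" by simp
    then show False using nondeg e by blast
  qed
  \<comment> \<open>This scaling absorbs the constant of proportionality, so that equal coefficients correspond.\<close>
  define d1 where "d1 = scale (- 1 / k) e"
  have d1: "d1 \<in> span {c', c}" "d1 \<notin> span {d0}"
  proof -
    show "d1 \<in> span {c', c}" unfolding d1_def using e by (intro span_scale)
    show "d1 \<notin> span {d0}"
    proof
      assume "d1 \<in> span {d0}"
      then have "scale (- k) d1 \<in> span {d0}" by (rule span_scale)
      then show False using e_ind \<open>k \<noteq> 0\<close> by (simp add: d1_def)
    qed
  qed
  have monic: "h a (b0 + scale t b1) (d0 + scale t d1)" for t
  proof -
    let ?u = "b0 + d0 + scale t b1" and ?w = "b0 + d0 + scale t d1"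
    have tau: "scale t d1 = scale (- t / k) e" by (simp add: d1_def)
    have w: "?w = ?u + scale (- t / k) (e + scale k b1)"
      using \<open>k \<noteq> 0\<close> by (simp add: tau scale_right_distrib)
    have "h a ?u (e + scale k b1)"
      by (rule h_add(2)[OF y h_scale(2)[OF h_add(1)[OF e(3) h_scale(1)[OF h_same(3)]]]])
    then have "h a ?u ?w" unfolding w
      by (rule h_add(1)[OF h_same(3) h_scale(1)])
    moreover have "h a d0 ?w" unfolding tau
      using d0 CC[OF d0(1) e(1)] h_swap23[OF d0(3)]
      by (intro h_add(1) h_scale(1)) (auto intro: h_same)
    ultimately have "h a (?u - d0) ?w" by (rule h_diff(2))
    then have "h a (b0 + scale t b1) ?w" by (simp add: algebra_simps)
    moreover have "h a (b0 + scale t b1) b0"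
      using bb by (intro h_add(2) h_scale(2)) (auto intro: h_same h_swap23)
    ultimately have "h a (b0 + scale t b1) (?w - b0)" by (rule h_diff(1))
    then show ?thesis by (simp add: algebra_simps)
  qed
  have "h a (scale s b0 + scale t b1) (scale s d0 + scale t d1)" for s t
  proof (cases "s = 0")
    case True
    have "h a (scale t b1) (scale t d1)" unfolding d1_def by (intro h_scale e(3))
    with True show ?thesis by simp
  next
    case False
    have "h a (scale s (b0 + scale (t / s) b1)) (scale s (d0 + scale (t / s) d1))"
      by (intro h_scale monic)
    with False show ?thesis by (simp add: scale_right_distrib)
  qed
  with d0 d1 that show ?thesis by blast
qed

end

lemma quadratic_root:
  fixes q e r :: "'a::field"
  assumes "quadratically_closed TYPE('a)" "q \<noteq> 0"
  shows "\<exists>s. q * s * s + e * s + r = 0"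
proof -
  let ?p = "[:r, e, q:]"
  have deg: "degree ?p = 2" using assms(2) by simp
  then have "\<not> irreducible ?p" using assms(1) by (auto simp: quadratically_closed_def)
  moreover have "?p \<noteq> 0" using deg by auto
  then have "\<not> ?p dvd 1" using deg is_unit_iff_degree[OF \<open>?p \<noteq> 0\<close>] by linarith
  ultimately obtain a b where ab: "?p = a * b" "\<not> a dvd 1" "\<not> b dvd 1"
    using \<open>?p \<noteq> 0\<close> unfolding irreducible_def by blast
  then have "a \<noteq> 0" "b \<noteq> 0" using \<open>?p \<noteq> 0\<close> by (metis mult_zero_left mult_zero_right)+
  moreover have "degree a + degree b = 2"
    using ab(1) deg calculation by (metis degree_mult_eq)
  ultimately have "degree a = 1" using ab(2,3) by (auto simp: is_unit_iff_degree)
  then obtain u v where a: "a = [:u, v:]" "v \<noteq> 0"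
    by (metis degree1_coeffs)
  have "poly ?p (- u / v) = 0" unfolding ab(1) poly_mult using a by simp
  then show ?thesis by (intro exI[of _ "- u / v"]) (simp add: algebra_simps)
qed

text \<open>The slopes \<open>s / t\<close> of the eigenvectors are the roots of \<open>q X\<^sup>2 + (w - p) X - r\<close>; for \<open>q = 0\<close> the vector
\<open>(1, 0)\<close> is one.\<close>

lemma eigenvector_2x2:
  fixes p q r w :: "'a::field"
  assumes "quadratically_closed TYPE('a)"
  obtains s t m :: 'a where "s \<noteq> 0 \<or> t \<noteq> 0" "s * p + t * r = m * s" "s * q + t * w = m * t"
proof (cases "q = 0")
  case True
  then show ?thesis using that[of 1 0 p] by simp
next
  case False
  obtain s where s: "q * s * s + (w - p) * s + - r = 0"
    using quadratic_root[OF assms False] by blast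
  show ?thesis
    by (rule that[of s 1 "s * q + w"]) (use s in \<open>simp_all add: algebra_simps\<close>)
qed

context spread_zero_relation
begin

lemma zero_on_rads:
  assumes "x \<noteq> 0" "u \<in> rad x" "v \<in> rad x"
  shows "h a u v" "h u v a"
proof -
  have "v \<in> rad u \<or> u = 0" using rad_eq[OF assms(1), of u] assms by blast
  then have "h u v a" unfolding rad_def using h_zero by blast
  then show "h u v a" "h a u v" using h_swap12 h_swap23 by blast+
qed

lemma span_rad_Un: "span (rad x \<union> rad y) = {u + v | u v. u \<in> rad x \<and> v \<in> rad y}"
  by (simp add: span_Un span_eq_iff[THEN iffD2, OF subspace_rad])

text \<open>A common vector \<open>u = a + b\<close> of \<open>rad z\<close> and \<open>rad x + rad y\<close> has \<open>h z (a + b) b'\<close> and \<open>h z b b'\<close>, hence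
\<open>h z a b'\<close>, for every \<open>b'\<close> in \<open>rad b\<close>. This contradicts \<open>not_all_zero_on_rad\<close>, so a spread line through a point outside the sum of two others is complementary to that sum.\<close>

lemma rad_disjoint_sum:
  assumes dim6: "dim (UNIV::'v set) = 6"
    and xy: "x \<noteq> 0" "y \<noteq> 0" "y \<notin> rad x" and z: "z \<notin> span (rad x \<union> rad y)"
    and u: "u \<in> rad z" "u \<in> span (rad x \<union> rad y)"
  shows "u = 0"
proof (rule ccontr)
  assume "u \<noteq> 0"
  obtain a b where ab: "u = a + b" "a \<in> rad x" "b \<in> rad y"
    using u(2) span_rad_Un by auto
  have zu: "z \<in> rad u" using u(1) by (rule rad_sym)
  have "a \<noteq> 0"
  proof
    assume "a = 0"
    then have "z \<in> rad y" using zu ab rad_eq[of y u] xy \<open>u \<noteq> 0\<close> by auto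
    then show False using z span_base by blast
  qed
  have "b \<noteq> 0"
  proof
    assume "b = 0"
    then have "z \<in> rad x" using zu ab rad_eq[of x u] xy \<open>u \<noteq> 0\<close> by auto
    then show False using z span_base by blast
  qed
  have rads: "rad a = rad x" "rad b = rad y"
    using rad_eq[OF xy(1) \<open>a \<noteq> 0\<close> ab(2)] rad_eq[OF xy(2) \<open>b \<noteq> 0\<close> ab(3)] .
  have "b \<notin> rad a"
    using rads(1) rad_disjoint[OF xy _ ab(3)] \<open>b \<noteq> 0\<close> by blast
  then obtain b' where b': "b' \<in> rad b" "\<not> h a b' z"
    using not_all_zero_on_rad[OF dim6 \<open>a \<noteq> 0\<close> \<open>b \<noteq> 0\<close>, of z] z rads by auto
  have "h z (a + b) b'" using u(1) ab(1) by (simp add: rad_def)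
  moreover have "h z b b'" using zero_on_rads[of b b b'] b' \<open>b \<noteq> 0\<close> self_in_rad by blast
  ultimately have "h z (a + b - b) b'" by (rule h_diff(2))
  then have "h z a b'" by simp
  then show False using b'(2) h_swap12 h_swap23 by blast
qed

theorem not_quadratically_closed_if_spread:
  assumes dim6: "dim (UNIV::'v set) = 6"
  shows "\<not> quadratically_closed TYPE('a)"
proof
  assume qc: "quadratically_closed TYPE('a)"
  obtain a :: 'v where a: "a \<noteq> 0" using obtain_outside[of "{}" UNIV] dim6 by auto
  have "dim (rad a) = 2" using dim_rad a by blast
  then obtain b0 where b0: "b0 \<notin> rad a"
    using obtain_outside[of "rad a" UNIV] dim6 span_eq_iff[THEN iffD2, OF subspace_rad] by auto
  then have "b0 \<noteq> 0" using subspace_0[OF subspace_rad] by metis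
  obtain b1 where b1: "b1 \<notin> span {b0}" "rad b0 = span {b1, b0}" using rad_line \<open>b0 \<noteq> 0\<close> by blast
  obtain a' where a': "a' \<notin> span {a}" "rad a = span {a', a}" using rad_line a by blast
  have "dim (span (rad a \<union> rad b0)) \<le> card {a, a', b0, b1}"
    unfolding a' b1 by (intro dim_le_card span_minimal Un_least subspace_span span_mono) (auto intro: span_base)
  also have "\<dots> \<le> 4" by (simp add: card_insert_if)
  finally obtain c where c: "c \<notin> span (rad a \<union> rad b0)"
    using obtain_outside[of "rad a \<union> rad b0" UNIV] dim6 by auto
  then have "c \<noteq> 0" using span_zero by blast
  obtain c' where c': "c' \<notin> span {c}" "rad c = span {c', c}" using rad_line \<open>c \<noteq> 0\<close> by blast
  have notin_sum: "v \<notin> span (rad a \<union> rad b0)" if "v \<in> rad c" "v \<noteq> 0" for v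
    using rad_disjoint_sum[OF dim6 a \<open>b0 \<noteq> 0\<close> b0 c] that by blast
  have nondeg:
    "\<exists>b\<in>rad b0. \<not> h x b v" if "x \<in> rad a" "x \<noteq> 0" "v \<in> rad c" "v \<noteq> 0" for x v
  proof -
    have "rad x = rad a" using rad_eq a that by blast
    then show ?thesis
      using not_all_zero_on_rad[OF dim6 \<open>x \<noteq> 0\<close> \<open>b0 \<noteq> 0\<close>, of v] notin_sum[of v] that b0 by auto
  qed
  have conj: "\<exists>d0 d1. d0 \<in> rad c \<and> d1 \<in> rad c \<and> d0 \<noteq> 0 \<and> d1 \<notin> span {d0} \<and>
     (\<forall>s t. h x (scale s b0 + scale t b1) (scale s d0 + scale t d1))"
    if x: "x \<in> rad a" "x \<noteq> 0" for x
  proof -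
    have bb: "h x b0 b1" "h x c c'"
      using zero_on_rads(1)[of b0 b0 b1 x] zero_on_rads(1)[of c c c' x] \<open>b0 \<noteq> 0\<close> \<open>c \<noteq> 0\<close>
         b1 c' by (auto intro: span_base)
    have nd: "\<not> (h x b0 v \<and> h x b1 v)" if v: "v \<in> span {c', c}" "v \<noteq> 0" for v
    proof -
      obtain b where "b \<in> rad b0" "\<not> h x b v" using nondeg x v c' by blast
      then show ?thesis using h_span[of b "{b1, b0}" x v] b1 h_swap23 by auto
    qed
    show ?thesis
      by (rule linear_conjugate_map[OF bb(1) \<open>c \<noteq> 0\<close> c'(1) bb(2) nd]) (use c' in auto)
  qed
  have a'_in: "a' \<in> rad a" "a' \<noteq> 0" using a' span_zero by (auto intro: span_base)
  obtain d0 d1 where d: "d0 \<in> rad c" "d1 \<in> rad c" "d0 \<noteq> 0" "d1 \<notin> span {d0}"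
     "\<And>s t. h a (scale s b0 + scale t b1) (scale s d0 + scale t d1)"
    using conj[OF self_in_rad a] by blast
  obtain e0 e1 where e: "e0 \<in> rad c" "e1 \<in> rad c" "e0 \<noteq> 0" "e1 \<notin> span {e0}"
     "\<And>s t. h a' (scale s b0 + scale t b1) (scale s e0 + scale t e1)"
    using conj[OF a'_in] by blast
  have "span {d1, d0} = rad c"
    using d subspace_dim_equal[of "span {d1, d0}" "rad c"] dim_rad[OF \<open>c \<noteq> 0\<close>] subspace_rad
    by (simp add: span_minimal dim_insert)
  have in_d: "\<exists>p q. v = scale p d0 + scale q d1" if v: "v \<in> rad c" for v
  proof -
    obtain q where "v - scale q d1 \<in> span {d0}"
      using v unfolding \<open>span {d1, d0} = rad c\<close>[symmetric] span_insert[of d1] by blast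
    then obtain p where "v - scale q d1 = scale p d0" by (auto simp: span_singleton)
    then have "v = scale p d0 + scale q d1" by (simp add: eq_diff_eq[symmetric] diff_eq_eq)
    then show ?thesis by blast
  qed
  \<comment> \<open>In the basis \<open>b0, b1\<close> the second map followed by the inverse of the first has the matrix with rows \<open>(p, q)\<close> and \<open>(r, w)\<close>.\<close>
  obtain p q where e0: "e0 = scale p d0 + scale q d1" using in_d e by blast
  obtain r w where e1: "e1 = scale r d0 + scale w d1" using in_d e by blast
  obtain s t m where st: "s \<noteq> 0 \<or> t \<noteq> 0" "s * p + t * r = m * s" "s * q + t * w = m * t"
    using eigenvector_2x2[OF qc] by blast
  let ?b = "scale s b0 + scale t b1" and ?v = "scale s d0 + scale t d1"
  have "scale s e0 + scale t e1 = scale (s * p + t * r) d0 + scale (s * q + t * w) d1"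
    by (simp add: e0 e1 scale_right_distrib scale_left_distrib algebra_simps)
  also have "\<dots> = scale m ?v" by (simp add: st scale_right_distrib)
  finally have e_eq: "scale s e0 + scale t e1 = scale m ?v" .
  have "scale s e0 + scale t e1 \<noteq> 0"
    using combination_notin_span[of e0 "{}" e1 s t] e st by simp
  then have "m \<noteq> 0" using e_eq by auto
  then have 1: "h a' ?b ?v" using e(5)[of s t] e_eq h_unscale(1) by metis
  have 2: "h a ?b ?v" using d(5) .
  have b: "?b \<in> rad b0" "?b \<noteq> 0"
    using combination_notin_span[of b0 "{}" b1 s t] b1 \<open>b0 \<noteq> 0\<close> st
    by (simp_all add: b1) (intro span_add span_scale; auto intro: span_base)
  have v: "?v \<in> rad c" "?v \<noteq> 0"
    using combination_notin_span[of d0 "{}" d1 s t] d st subspace_rad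
    by (simp_all add: subspace_add subspace_scale)
  have rad_b: "rad ?b = rad b0" using rad_eq[OF \<open>b0 \<noteq> 0\<close> b(2,1)] .
  then have "a \<notin> rad ?b" using b0 rad_sym by blast
  moreover have "?v \<notin> span (rad ?b \<union> rad a)" using notin_sum[OF v] rad_b by (simp add: Un_commute)
  ultimately obtain x where "x \<in> rad a" "\<not> h ?b x ?v"
    using not_all_zero_on_rad[OF dim6 b(2) a] by blast
  then show False
    using h_span[of x "{a', a}" ?b ?v] 1 2 a' h_swap12 h_swap13 h_swap23 by blast
qed

end

section \<open>Hyperplanes and alternating zero relations\<close>

context finite_dimensional_vector_space
begin

lemma plane_lines_iff:
  "l \<in> grassmann_lines scale 3 \<longleftrightarrow>
    (\<exists>Y Z. Y \<in> subspaces_of_dim scale 2 \<and> Z \<in> subspaces_of_dim scale 4 \<and> Y \<subseteq> Z \<and>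
      l = {X \<in> subspaces_of_dim scale 3. Y \<subseteq> X \<and> X \<subseteq> Z})"
proof -
  have "(3::nat) - 1 = 2" "(3::nat) + 1 = 4" by simp_all
  then show ?thesis unfolding grassmann_lines_def by (auto simp only: mem_Collect_eq)
qed

lemma span_in_subspaces_of_dim: "span S \<in> subspaces_of_dim scale k \<longleftrightarrow> dim S = k"
  by (simp add: subspaces_of_dim_def)

lemma eq_span_insert:
  assumes "X \<in> subspaces_of_dim scale (Suc (dim S))" "S \<subseteq> X" "u \<in> X" "u \<notin> span S"
  shows "X = span (insert u S)"
proof -
  have X: "subspace X" "dim X = Suc (dim S)" using assms(1) by (auto simp: subspaces_of_dim_def)
  have "span (insert u S) \<subseteq> X" using assms X by (intro span_minimal) auto
  moreover have "dim X \<le> dim (span (insert u S))" using X assms by (simp add: dim_insert)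
  ultimately show ?thesis using subspace_dim_equal[of "span (insert u S)" X] X by simp
qed

lemma obtain_span_insert:
  assumes "X \<in> subspaces_of_dim scale (Suc (dim S))" "S \<subseteq> X"
  obtains u where "u \<in> X" "u \<notin> span S" "X = span (insert u S)"
proof -
  have "dim X = Suc (dim S)" using assms(1) by (auto simp: subspaces_of_dim_def)
  then have "\<not> X \<subseteq> span S" using dim_mono[of X S] by auto
  then show ?thesis using eq_span_insert[OF assms] that by blast
qed

lemma obtain_span_pair:
  assumes "A \<in> subspaces_of_dim scale 2" "x \<in> A" "x \<noteq> 0"
  obtains y where "y \<notin> span {x}" "A = span {y, x}"
  using obtain_span_insert[of A "{x}"] assms by (auto simp: numeral_2_eq_2)

lemma obtain_span_singleton:
  assumes "p \<in> subspaces_of_dim scale 1"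
  obtains x where "x \<noteq> 0" "p = span {x}"
  using obtain_span_insert[of p "{}"] assms by auto

lemma obtain_line_basis:
  assumes "A \<in> subspaces_of_dim scale 2"
  obtains x y where "x \<noteq> 0" "y \<notin> span {x}" "A = span {y, x}"
proof -
  have "dim A = 2" using assms by (simp add: subspaces_of_dim_def)
  then have "\<not> A \<subseteq> span {}" using dim_mono[of A "{}"] by force
  then obtain x where "x \<in> A" "x \<noteq> 0" by auto
  then show ?thesis using obtain_span_pair[OF assms] that by metis
qed

lemma dim_pair: "x \<noteq> 0 \<Longrightarrow> y \<notin> span {x} \<Longrightarrow> dim {y, x} = 2"
  by (simp add: dim_insert)

lemma dim_triple_iff: "dim {z, y, x} = 3 \<longleftrightarrow> dim {y, x} = 2 \<and> z \<notin> span {y, x}"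
proof -
  have "dim {y, x} \<le> 2" by (simp add: dim_insert)
  then show ?thesis by (auto simp: dim_insert[of z])
qed

lemma hyperplane_contains_line:
  assumes "grassmann_hyperplane scale k H" "l \<in> grassmann_lines scale k"
    and "X \<in> l" "X' \<in> l" "X \<in> H" "X' \<in> H" "X \<noteq> X'"
  shows "l \<subseteq> H"
proof -
  have "\<exists>x\<in>l \<inter> H. \<exists>y\<in>l \<inter> H. x \<noteq> y" using assms by blast
  then show ?thesis
    using assms(1,2) unfolding grassmann_hyperplane_def geometry_hyperplane_def geometry_subspace_def
    by simp
qed

text \<open>Dependent triples count as zeros, as they do for an alternating form; without this convention the
zeros in one argument would not form a subspace.\<close>

definition triple_in :: "'b set set \<Rightarrow> 'b \<Rightarrow> 'b \<Rightarrow> 'b \<Rightarrow> bool" where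
  "triple_in H x y z \<longleftrightarrow> (dim {z, y, x} = 3 \<longrightarrow> span {z, y, x} \<in> H)"

lemma triple_in_iff: "dim {z, y, x} = 3 \<Longrightarrow> span {z, y, x} \<in> H \<longleftrightarrow> triple_in H x y z"
  by (simp add: triple_in_def)

text \<open>If \<open>x, y, u, v\<close> are independent, the planes through \<open>x, y\<close> inside their span form a line of the
geometry, and two points of this line belong to \<open>H\<close>. In the remaining cases the plane in question
is one of the two given ones.\<close>

lemma triple_in_combination:
  assumes H: "grassmann_hyperplane scale 3 H"
    and u: "triple_in H x y u" and v: "triple_in H x y v"
  shows "triple_in H x y (scale s u + scale t v)"
  unfolding triple_in_def
proof
  let ?w = "scale s u + scale t v"
  assume "dim {?w, y, x} = 3"
  then have d2: "dim {y, x} = 2" and w: "?w \<notin> span {y, x}" by (auto simp: dim_triple_iff)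
  have eq: "span {?w, y, x} \<in> H" if "z \<notin> span {y, x}" "?w \<in> span {z, y, x}" "triple_in H x y z" for z
  proof -
    have "span {z, y, x} \<in> subspaces_of_dim scale (Suc (dim {y, x}))"
      using that d2 by (simp add: span_in_subspaces_of_dim dim_insert[of z])
    then have "span {z, y, x} = span {?w, y, x}"
      by (rule eq_span_insert) (use that w in \<open>auto intro: span_base\<close>)
    moreover have "span {z, y, x} \<in> H" using that d2 by (simp add: triple_in_def dim_triple_iff)
    ultimately show ?thesis by simp
  qed
  show "span {?w, y, x} \<in> H"
  proof (cases "u \<in> span {y, x}")
    case True
    then have "v \<notin> span {y, x}" using w by (auto intro: span_add span_scale)
    moreover have "u \<in> span {v, y, x}" using True span_mono[of "{y,x}" "{v,y,x}"] by blast
    then have "?w \<in> span {v, y, x}" by (intro span_add span_scale) (auto intro: span_base)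
    ultimately show ?thesis using eq v by blast
  next
    case False
    show ?thesis
    proof (cases "v \<in> span {u, y, x}")
      case True
      then have "?w \<in> span {u, y, x}" by (intro span_add span_scale) (auto intro: span_base)
      then show ?thesis using eq u False by blast
    next
      case v_notin: False
      then have v': "v \<notin> span {y, x}" using span_mono[of "{y,x}" "{u,y,x}"] by blast
      let ?Z = "span {v, u, y, x}"
      let ?l = "{X \<in> subspaces_of_dim scale 3. span {y, x} \<subseteq> X \<and> X \<subseteq> ?Z}"
      have "?Z \<in> subspaces_of_dim scale 4"
        using v_notin False d2 by (simp add: span_in_subspaces_of_dim dim_insert[of v] dim_insert[of u])
      moreover have "span {y, x} \<in> subspaces_of_dim scale 2" "span {y, x} \<subseteq> ?Z"
        using d2 by (auto simp: span_in_subspaces_of_dim intro!: span_mono)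
      ultimately have l: "?l \<in> grassmann_lines scale 3"
        unfolding plane_lines_iff by blast
      have in_l: "span {z, y, x} \<in> ?l" if "z \<notin> span {y, x}" "z \<in> ?Z" for z
      proof -
        have "span {y, x} \<subseteq> span {z, y, x}" by (intro span_mono) auto
        moreover have "span {z, y, x} \<subseteq> ?Z" using that by (intro span_minimal) (auto intro: span_base)
        ultimately show ?thesis using that d2 by (simp add: span_in_subspaces_of_dim dim_triple_iff)
      qed
      have "span {u, y, x} \<in> ?l" "span {v, y, x} \<in> ?l"
        using in_l False v' by (auto intro: span_base)
      moreover have "span {u, y, x} \<in> H" "span {v, y, x} \<in> H"
        using u v False v' d2 by (auto simp: triple_in_def dim_triple_iff)
      moreover have "span {u, y, x} \<noteq> span {v, y, x}"
        using v_notin span_base[of v "{v, y, x}"] by auto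
      ultimately have "?l \<subseteq> H"
        using hyperplane_contains_line[OF H l] by blast
      moreover have "?w \<in> ?Z" by (intro span_add span_scale) (auto intro: span_base)
      ultimately show ?thesis using in_l w by blast
    qed
  qed
qed

text \<open>Unless some combination of \<open>u\<close> and \<open>v\<close> is dependent on \<open>x, y\<close>, the claim says that \<open>H\<close> meets the line
of the geometry between \<open>\<langle>x, y\<rangle>\<close> and \<open>\<langle>x, y, u, v\<rangle>\<close>; a generator of the plane found there is reduced
modulo \<open>\<langle>x, y\<rangle>\<close> to a combination of \<open>u\<close> and \<open>v\<close>.\<close>

lemma triple_in_meets_line:
  assumes H: "grassmann_hyperplane scale 3 H"
  shows "\<exists>s t. (s \<noteq> 0 \<or> t \<noteq> 0) \<and> triple_in H x y (scale s u + scale t v)"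
proof (cases "\<exists>s t. (s \<noteq> 0 \<or> t \<noteq> 0) \<and> dim {scale s u + scale t v, y, x} \<noteq> 3")
  case True
  then show ?thesis by (auto simp: triple_in_def)
next
  case False
  then have nz: "dim {scale s u + scale t v, y, x} = 3" if "s \<noteq> 0 \<or> t \<noteq> 0" for s t
    using that by blast
  from nz[of 1 0] have d2: "dim {y, x} = 2" and u: "u \<notin> span {y, x}"
    by (auto simp: dim_triple_iff)
  have v: "v \<notin> span {u, y, x}"
  proof
    assume "v \<in> span {u, y, x}"
    then obtain k where "v - scale k u \<in> span {y, x}" unfolding span_insert[of u] by blast
    with nz[of "- k" 1] show False by (simp add: dim_triple_iff)
  qed
  let ?Z = "span {v, u, y, x}"
  let ?l = "{X \<in> subspaces_of_dim scale 3. span {y, x} \<subseteq> X \<and> X \<subseteq> ?Z}"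
  have "?Z \<in> subspaces_of_dim scale 4"
    using u v d2 by (simp add: span_in_subspaces_of_dim dim_insert[of v] dim_insert[of u])
  moreover have "span {y, x} \<in> subspaces_of_dim scale 2" "span {y, x} \<subseteq> ?Z"
    using d2 by (auto simp: span_in_subspaces_of_dim intro!: span_mono)
  ultimately have l: "?l \<in> grassmann_lines scale 3"
    unfolding plane_lines_iff by blast
  then obtain X where X: "X \<in> ?l" "X \<in> H"
    using H unfolding grassmann_hyperplane_def geometry_hyperplane_def by blast
  have X3: "X \<in> subspaces_of_dim scale (Suc (dim {y, x}))" and yx: "{y, x} \<subseteq> X"
    using X d2 span_superset[of "{y, x}"] by auto
  obtain r where r: "r \<in> X" "r \<notin> span {y, x}" using obtain_span_insert[OF X3 yx] by blast
  then have "r \<in> ?Z" using X by blast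
  then obtain t where "r - scale t v \<in> span {u, y, x}" unfolding span_insert[of v] by blast
  then obtain s where st: "r - scale t v - scale s u \<in> span {y, x}" unfolding span_insert[of u] by blast
  let ?w = "scale s u + scale t v"
  have diff: "r - ?w \<in> span {y, x}" using st by (simp add: algebra_simps)
  have w: "?w \<notin> span {y, x}"
  proof
    assume "?w \<in> span {y, x}"
    from span_add[OF diff this] r show False by simp
  qed
  have "span {y, x} \<subseteq> X" using X by blast
  moreover have "subspace X" using X by (simp add: subspaces_of_dim_def)
  ultimately have "r - (r - ?w) \<in> X" using subspace_diff diff r(1) by blast
  then have "?w \<in> X" by (simp only: diff_diff_eq2 add_diff_cancel_left')
  then have "X = span {?w, y, x}" using eq_span_insert[OF X3 yx] w by blast
  moreover have "s \<noteq> 0 \<or> t \<noteq> 0" using w span_zero by auto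
  ultimately show ?thesis using X unfolding triple_in_def by blast
qed

lemma hyperplane_zero_relation:
  assumes H: "grassmann_hyperplane scale 3 H"
  shows "alternating_zero_relation scale Basis (triple_in H)"
proof
  show "triple_in H y x z" if "triple_in H x y z" for x y z
    using that by (simp add: triple_in_def insert_commute)
  show "triple_in H x z y" if "triple_in H x y z" for x y z
    using that by (simp add: triple_in_def insert_commute)
  show "triple_in H x x z" for x z
    by (simp add: triple_in_def dim_triple_iff) (simp add: dim_insert)
  show "subspace {z. triple_in H x y z}" for x y
  proof (rule subspaceI)
    show "0 \<in> {z. triple_in H x y z}"
      by (simp add: triple_in_def dim_triple_iff span_zero)
    show "u + v \<in> {z. triple_in H x y z}"
      if "u \<in> {z. triple_in H x y z}" "v \<in> {z. triple_in H x y z}" for u v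
      using triple_in_combination[OF H, of x y u v 1 1] that by simp
    show "scale c u \<in> {z. triple_in H x y z}" if "u \<in> {z. triple_in H x y z}" for c u
      using triple_in_combination[OF H, of x y u u c 0] that by simp
  qed
  show "\<exists>s t. (s \<noteq> 0 \<or> t \<noteq> 0) \<and> triple_in H x y (scale s u + scale t v)" for x y u v
    by (rule triple_in_meets_line[OF H])
qed

end

context alternating_zero_relation
begin

definition zero_set :: "'v set set" where
  "zero_set = {X \<in> subspaces_of_dim scale 3. \<forall>x\<in>X. \<forall>y\<in>X. \<forall>z\<in>X. h x y z}"

lemma zero_set_iff:
  assumes "dim {z, y, x} = 3"
  shows "span {z, y, x} \<in> zero_set \<longleftrightarrow> h x y z"
proof
  assume "span {z, y, x} \<in> zero_set"
  moreover have "{x, y, z} \<subseteq> span {z, y, x}" using span_superset[of "{z, y, x}"] by auto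
  ultimately show "h x y z" by (auto simp: zero_set_def)
next
  assume hyp: "h x y z"
  have perms: "h x y z" "h x z y" "h y x z" "h y z x" "h z x y" "h z y x"
    using hyp h_swap12 h_swap23 by blast+
  have "h u v w" if "u \<in> {z, y, x}" "v \<in> {z, y, x}" "w \<in> {z, y, x}" for u v w
    using that perms h_same by auto
  then have "\<forall>u\<in>span {z, y, x}. \<forall>v\<in>span {z, y, x}. \<forall>w\<in>span {z, y, x}. h u v w"
    using h_span3[of "{z, y, x}"] by blast
  with assms show "span {z, y, x} \<in> zero_set"
    by (simp add: zero_set_def span_in_subspaces_of_dim)
qed

lemma nonzero_independent:
  assumes "\<not> h x y z"
  shows "x \<noteq> 0" "y \<notin> span {x}" "z \<notin> span {y, x}"
proof -
  show "x \<noteq> 0" using assms h_zero by blast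
  show "y \<notin> span {x}"
  proof
    assume "y \<in> span {x}"
    from h_span[OF this, of x z] have "h x z y" using h_same by blast
    with assms h_swap23 show False by blast
  qed
  show "z \<notin> span {y, x}" using h_span[of z "{y, x}" x y] h_same assms by blast
qed

text \<open>The converse passage: both line conditions of a hyperplane translate directly into the subspace and
the codimension axiom for the zeros of \<open>h x y\<close>, where \<open>x, y\<close> span the lower end of the line.\<close>

lemma grassmann_hyperplane_zero_set:
  assumes "\<not> h x0 y0 z0"
  shows "grassmann_hyperplane scale 3 zero_set"
  unfolding grassmann_hyperplane_def geometry_hyperplane_def geometry_subspace_def
proof (intro conjI ballI impI)
  show "zero_set \<subseteq> subspaces_of_dim scale 3" by (auto simp: zero_set_def)
next
  have "dim {z0, y0, x0} = 3"
    using nonzero_independent[OF assms] by (simp add: dim_triple_iff dim_pair)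
  then show "zero_set \<noteq> subspaces_of_dim scale 3"
    using zero_set_iff assms span_in_subspaces_of_dim by blast
next
  fix l assume "l \<in> grassmann_lines scale 3"
  then obtain Y Z where YZ: "Y \<in> subspaces_of_dim scale 2" "Z \<in> subspaces_of_dim scale 4" "Y \<subseteq> Z"
    and l: "l = {X \<in> subspaces_of_dim scale 3. Y \<subseteq> X \<and> X \<subseteq> Z}"
    unfolding plane_lines_iff by blast
  obtain x y where xy: "x \<noteq> 0" "y \<notin> span {x}" "Y = span {y, x}"
    using obtain_line_basis[OF YZ(1)] .
  have d2: "dim {y, x} = 2" using dim_pair xy by blast
  have yx: "{y, x} \<subseteq> Y" unfolding xy by (rule span_superset)
  have subZ: "subspace Z" "dim Z = 4" using YZ by (auto simp: subspaces_of_dim_def)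
  {
    assume "\<exists>X\<in>l \<inter> zero_set. \<exists>X'\<in>l \<inter> zero_set. X \<noteq> X'"
    then obtain X1 X2 where X: "X1 \<in> l" "X1 \<in> zero_set" "X2 \<in> l" "X2 \<in> zero_set" "X1 \<noteq> X2" by blast
    have basis: "\<exists>w. w \<in> X \<and> w \<notin> span {y, x} \<and> X = span {w, y, x}" if "X \<in> l" for X
    proof -
      have "X \<in> subspaces_of_dim scale (Suc (dim {y, x}))" "{y, x} \<subseteq> X" using that l d2 yx by auto
      from obtain_span_insert[OF this] show ?thesis by blast
    qed
    obtain u where u: "u \<in> X1" "u \<notin> span {y, x}" "X1 = span {u, y, x}" using basis X by blast
    obtain v where v: "v \<in> X2" "v \<notin> span {y, x}" "X2 = span {v, y, x}" using basis X by blast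
    have "v \<notin> X1"
    proof
      assume "v \<in> X1"
      then have "X1 = span {v, y, x}"
        using X(1) l d2 yx v by (intro eq_span_insert) auto
      with v X show False by simp
    qed
    moreover have "Z \<in> subspaces_of_dim scale (Suc (dim {u, y, x}))" "{u, y, x} \<subseteq> Z"
      using YZ d2 u yx X l by (auto simp: dim_insert[of u])
    moreover have "v \<in> Z" using v X l by blast
    ultimately have Z: "Z = span {v, u, y, x}" using eq_span_insert u by blast
    have huv: "h x y u" "h x y v"
      using zero_set_iff[of u y x] zero_set_iff[of v y x] X u v d2 by (auto simp: dim_triple_iff)
    show "l \<subseteq> zero_set"
    proof
      fix X assume X: "X \<in> l"
      obtain w where w: "w \<in> X" "w \<notin> span {y, x}" "X = span {w, y, x}" using basis X by blast
      have "w \<in> Z" using X l w by blast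
      then have "h x y w" using h_span[of w "{v, u, y, x}" x y] Z huv h_same by blast
      then show "X \<in> zero_set" using zero_set_iff w d2 dim_triple_iff by blast
    qed
  }
  obtain u where u: "u \<in> Z" "u \<notin> span {y, x}" using obtain_outside[of "{y, x}" Z] d2 subZ by auto
  have d3: "dim {u, y, x} = 3" using u d2 dim_triple_iff by blast
  obtain v where v: "v \<in> Z" "v \<notin> span {u, y, x}" using obtain_outside[of "{u, y, x}" Z] d3 subZ by auto
  obtain s t where st: "s \<noteq> 0 \<or> t \<noteq> 0" "h x y (scale s u + scale t v)" using h_meets_line by blast
  let ?w = "scale s u + scale t v"
  have w: "?w \<notin> span {y, x}" using combination_notin_span[OF u(2) v(2) st(1)] .
  have "?w \<in> Z" using u v subZ by (intro subspace_add subspace_scale)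
  then have "span {?w, y, x} \<subseteq> Z" using yx YZ subZ by (intro span_minimal) auto
  moreover have "Y \<subseteq> span {?w, y, x}" unfolding xy by (intro span_mono) auto
  ultimately have "span {?w, y, x} \<in> l \<inter> zero_set"
    using zero_set_iff[of ?w y x] st w d2 by (simp add: l dim_triple_iff span_in_subspaces_of_dim)
  then show "l \<inter> zero_set \<noteq> {}" by blast
qed

text \<open>The set \<open>H\<close> is kept arbitrary up to its agreement with \<open>h\<close> on independent triples, so that the result
applies both to a given hyperplane with its relation and to a given relation with its zero set.\<close>

lemma upper_radical_iff:
  assumes H: "\<And>x y z. dim {z, y, x} = 3 \<Longrightarrow> span {z, y, x} \<in> H \<longleftrightarrow> h x y z"
    and xy: "x \<noteq> 0" "y \<notin> span {x}"
  shows "span {y, x} \<in> upper_radical scale H \<longleftrightarrow> y \<in> rad x"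
proof
  have d2: "dim {y, x} = 2" using dim_pair xy by blast
  {
    assume A: "span {y, x} \<in> upper_radical scale H"
    have "h x y z" for z
    proof (cases "z \<in> span {y, x}")
      case True
      then show ?thesis using h_span[of z "{y, x}" x y] h_same by blast
    next
      case False
      then have d3: "dim {z, y, x} = 3" using d2 dim_triple_iff by blast
      moreover have "span {y, x} \<subseteq> span {z, y, x}" by (intro span_mono) auto
      ultimately show ?thesis using A H by (auto simp: upper_radical_def span_in_subspaces_of_dim)
    qed
    then show "y \<in> rad x" unfolding rad_def by blast
  next
    assume "y \<in> rad x"
    then have h: "h x y z" for z unfolding rad_def by blast
    have "X \<in> H" if X: "X \<in> subspaces_of_dim scale 3" "span {y, x} \<subseteq> X" for X
    proof -
      have "X \<in> subspaces_of_dim scale (Suc (dim {y, x}))" "{y, x} \<subseteq> X"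
        using X d2 span_superset[of "{y, x}"] by auto
      then obtain z where "z \<notin> span {y, x}" "X = span {z, y, x}" using obtain_span_insert by blast
      then show ?thesis using H h d2 dim_triple_iff by blast
    qed
    then show "span {y, x} \<in> upper_radical scale H"
      using d2 by (auto simp: upper_radical_def span_in_subspaces_of_dim)
  }
qed

lemma line_spread_upper_radical_iff:
  assumes H: "\<And>x y z. dim {z, y, x} = 3 \<Longrightarrow> span {z, y, x} \<in> H \<longleftrightarrow> h x y z"
  shows "line_spread scale (upper_radical scale H) \<longleftrightarrow>
    (\<forall>x. x \<noteq> 0 \<longrightarrow> (\<exists>y. y \<notin> span {x} \<and> rad x = span {y, x}))"
proof
  have R_dim: "A \<in> subspaces_of_dim scale 2" if "A \<in> upper_radical scale H" for A
    using that by (simp add: upper_radical_def)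
  have R_sub: "A \<subseteq> rad x" if A: "A \<in> upper_radical scale H" "x \<in> A" "x \<noteq> 0" for A x
  proof -
    obtain y where y: "y \<notin> span {x}" "A = span {y, x}"
      using obtain_span_pair[OF R_dim] A by blast
    then have "y \<in> rad x" using upper_radical_iff[OF H] A by blast
    then show ?thesis using y self_in_rad by (simp add: span_minimal subspace_rad)
  qed
  {
    assume spread: "line_spread scale (upper_radical scale H)"
    show "\<forall>x. x \<noteq> 0 \<longrightarrow> (\<exists>y. y \<notin> span {x} \<and> rad x = span {y, x})"
    proof (intro allI impI)
      fix x :: 'v assume x: "x \<noteq> 0"
      then have "span {x} \<in> subspaces_of_dim scale 1" by (simp add: span_in_subspaces_of_dim)
      then have ex: "\<exists>!A. A \<in> upper_radical scale H \<and> span {x} \<subseteq> A"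
        using spread unfolding line_spread_def by blast
      then obtain A where A: "A \<in> upper_radical scale H" "span {x} \<subseteq> A" by blast
      have xA: "x \<in> A" using A span_base[of x "{x}"] by blast
      obtain y where y: "y \<notin> span {x}" "A = span {y, x}"
        using obtain_span_pair[OF R_dim] A x xA by blast
      have "v \<in> A" if "v \<in> rad x" for v
      proof (cases "v \<in> span {x}")
        case True
        then show ?thesis using A by blast
      next
        case False
        then have "span {v, x} \<in> upper_radical scale H" using upper_radical_iff[OF H x] that by blast
        moreover have "span {x} \<subseteq> span {v, x}" by (intro span_mono) auto
        ultimately have "span {v, x} = A" using ex A by blast
        then show ?thesis using span_base[of v "{v, x}"] by blast
      qed
      then show "\<exists>y. y \<notin> span {x} \<and> rad x = span {y, x}"
        using R_sub[OF A(1) xA x] y by blast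
    qed
  next
    assume line: "\<forall>x. x \<noteq> 0 \<longrightarrow> (\<exists>y. y \<notin> span {x} \<and> rad x = span {y, x})"
    show "line_spread scale (upper_radical scale H)"
      unfolding line_spread_def
    proof (intro conjI ballI)
      show "upper_radical scale H \<subseteq> subspaces_of_dim scale 2" using R_dim by blast
    next
      fix p assume "p \<in> subspaces_of_dim scale 1"
      then obtain x where x: "x \<noteq> 0" "p = span {x}" by (rule obtain_span_singleton)
      obtain y where y: "y \<notin> span {x}" "rad x = span {y, x}" using line x by blast
      show "\<exists>!A. A \<in> upper_radical scale H \<and> p \<subseteq> A"
      proof (rule ex1I)
        have "y \<in> rad x" using y by (simp add: span_base)
        then show "rad x \<in> upper_radical scale H \<and> p \<subseteq> rad x"
          using upper_radical_iff[OF H x(1) y(1)] y x(2) by (auto intro: span_mono[THEN subsetD])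
      next
        fix A assume A: "A \<in> upper_radical scale H \<and> p \<subseteq> A"
        then have "x \<in> A" using x span_base[of x "{x}"] by blast
        then have "A \<subseteq> rad x" using R_sub A x by blast
        moreover have "subspace A" "dim A = 2" using R_dim A by (auto simp: subspaces_of_dim_def)
        moreover have "dim (rad x) = 2" using y x dim_pair by simp
        ultimately show "A = rad x" using subspace_dim_equal[of A "rad x"] subspace_rad by simp
      qed
    qed
  }
qed

end

section \<open>The spread of a quadratic extension\<close>

text \<open>Elements of \<open>\<K>[t]/(p)\<close> are represented by polynomials of degree below two and computed with
modulo \<open>p\<close>, since a field type cannot depend on \<open>p\<close>. Each vector of the six-dimensional space thus
has three polynomial coordinates, made from consecutive pairs of its coordinates in a basis.\<close>

lemma (in finite_dimensional_vector_space) obtain_linear_poly_coordinates: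
  assumes "dim (UNIV::'b set) = 6"
  obtains X :: "nat \<Rightarrow> 'b \<Rightarrow> 'a poly" where
    "\<And>i u v. X i (u + v) = X i u + X i v" "\<And>i c u. X i (scale c u) = smult c (X i u)"
    "\<And>i u. degree (X i u) < 2" "\<And>u v. (\<And>i. i < 3 \<Longrightarrow> X i u = X i v) \<Longrightarrow> u = v"
    "\<And>f. (\<And>i. degree (f i) < 2) \<Longrightarrow> \<exists>u. \<forall>i<3. X i u = f i"
proof -
  have "card Basis = 6" using assms by simp
  then obtain e where e: "bij_betw e {0..<6::nat} Basis"
    using ex_bij_betw_nat_finite[OF finite_Basis] by auto
  let ?r = "representation Basis"
  define X where "X i v = [:?r v (e (2 * i)), ?r v (e (2 * i + 1)):]" for i v
  have in_span: "v \<in> span Basis" for v by (simp add: span_Basis)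
  show thesis
  proof (rule that[of X])
    show "X i (u + v) = X i u + X i v" for i u v
      using in_span by (simp add: X_def representation_add independent_Basis)
    show "X i (scale c u) = smult c (X i u)" for i c u
      using in_span by (simp add: X_def representation_scale independent_Basis)
    show "degree (X i u) < 2" for i u by (simp add: X_def)
    show "u = v" if eq: "\<And>i. i < 3 \<Longrightarrow> X i u = X i v" for u v
    proof -
      have "?r u b = ?r v b" if "b \<in> Basis" for b
      proof -
        have "b \<in> e ` {0..<6}" using that bij_betw_imp_surj_on[OF e] by simp
        then obtain k where k: "k < 6" "b = e k" by auto
        then have "X (k div 2) u = X (k div 2) v" by (intro eq) auto
        then have "?r u (e (2 * (k div 2))) = ?r v (e (2 * (k div 2)))"
          "?r u (e (2 * (k div 2) + 1)) = ?r v (e (2 * (k div 2) + 1))" by (simp_all add: X_def)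
        moreover have "k = 2 * (k div 2) \<or> k = 2 * (k div 2) + 1" by presburger
        ultimately show ?thesis using k(2) by metis
      qed
      then have "(\<Sum>b\<in>Basis. scale (?r u b) b) = (\<Sum>b\<in>Basis. scale (?r v b) b)" by simp
      then show ?thesis
        using sum_representation_eq[OF independent_Basis in_span finite_Basis order_refl] by simp
    qed
    show "\<exists>u. \<forall>i<3. X i u = f i" if f: "\<And>i. degree (f i) < 2" for f
    proof -
      define g where "g k = coeff (f (k div 2)) (k mod 2)" for k
      define u where "u = (\<Sum>k\<in>{0..<6}. scale (g k) (e k))"
      have r: "?r u (e j) = g j" if "j < 6" for j
      proof -
        have "?r u (e j) = (\<Sum>k\<in>{0..<6}. g k * ?r (e k) (e j))"
          using in_span by (simp add: u_def representation_sum representation_scale independent_Basis)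
        also have "\<dots> = (\<Sum>k\<in>{0..<6}. if k = j then g k else 0)"
        proof (rule sum.cong)
          fix k assume k: "k \<in> {0..<6::nat}"
          then have "e k \<in> Basis" using e by (auto simp: bij_betw_def)
          moreover have "e k = e j \<longleftrightarrow> k = j" using e k that by (auto simp: bij_betw_def inj_on_def)
          ultimately show "g k * ?r (e k) (e j) = (if k = j then g k else 0)"
            by (auto simp: representation_basis independent_Basis)
        qed simp
        also have "\<dots> = g j" using that by simp
        finally show ?thesis .
      qed
      have "X i u = f i" if "i < 3" for i
      proof (rule poly_eqI)
        fix n :: nat
        consider "n = 0" | "n = 1" | "n \<ge> 2" by linarith
        then show "coeff (X i u) n = coeff (f i) n"
        proof cases
          case 3
          then show ?thesis using f[of i] by (simp add: X_def coeff_eq_0)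
        qed (use that r in \<open>simp_all add: X_def g_def\<close>)
      qed
      then show ?thesis by blast
    qed
  qed
qed

text \<open>For linear \<open>a\<close> one division with remainder suffices: \<open>p = q a + k\<close> with a constant \<open>k\<close>, which is
non-zero by irreducibility, so \<open>- q / k\<close> inverts \<open>a\<close> modulo \<open>p\<close>.\<close>

lemma irreducible_quadratic_inverse:
  fixes p a :: "'a::field poly"
  assumes p: "degree p = 2" "irreducible p" and a: "a \<noteq> 0" "degree a < 2"
  obtains w where "p dvd w * a - 1"
proof (cases "degree a = 0")
  case True
  then obtain k where k: "a = [:k:]" "k \<noteq> 0" using a(1) by (metis degree_0_id pCons_0_0)
  then have "[:1 / k:] * a - 1 = 0" by simp
  then show ?thesis using that[of "[:1 / k:]"] by (simp only: dvd_0_right)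
next
  case False
  have "degree (p mod a) = 0" using degree_mod_less[OF a(1), of p] False a(2) by auto
  then obtain k where k: "p mod a = [:k:]" by (metis degree_0_id)
  have "k \<noteq> 0"
  proof
    assume "k = 0"
    then have "a dvd p" using k by (simp add: mod_eq_0_iff_dvd)
    then obtain b where b: "p = a * b" ..
    then have nz: "b \<noteq> 0" using p by auto
    have "a dvd 1 \<or> b dvd 1" using p(2) b by (rule irreducibleD)
    then have "degree a = 0 \<or> degree b = 0" using is_unit_iff_degree[OF a(1)] is_unit_iff_degree[OF nz] by simp
    then show False using False p(1) a nz unfolding b by (auto simp: degree_mult_eq)
  qed
  define w where "w = - smult (1 / k) (p div a)"
  have "(p div a) * a = p - [:k:]" using div_mult_mod_eq[of p a] k by (simp add: eq_diff_eq)
  then have "w * a - 1 = - smult (1 / k) (p - [:k:]) - 1" by (simp add: w_def)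
  also have "\<dots> = smult (- 1 / k) p" using \<open>k \<noteq> 0\<close> by (simp add: smult_diff_right one_pCons)
  finally have "p dvd w * a - 1" by (simp add: dvd_smult)
  then show ?thesis by (rule that)
qed

text \<open>Vectors over the field \<open>\<K>[t]/(p)\<close> whose \<open>2 \<times> 2\<close> minors vanish are proportional; the factor is
\<open>b i / a i\<close>.\<close>

lemma proportional_if_cross_products_vanish:
  fixes p :: "'a::field poly" and a b :: "'i \<Rightarrow> 'a poly"
  assumes p: "degree p = 2" "irreducible p" and a: "degree (a i) < 2" "a i \<noteq> 0"
    and cross: "\<And>j. j \<in> J \<Longrightarrow> p dvd a i * b j - a j * b i"
  obtains c where "degree c < 2" "\<And>j. j \<in> J \<Longrightarrow> p dvd b j - c * a j"
proof -
  obtain w where w: "p dvd w * a i - 1" using irreducible_quadratic_inverse[OF p a(2,1)] .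
  define c where "c = (w * b i) mod p"
  have "p \<noteq> 0" using p by auto
  have "degree c < 2" using degree_mod_less[OF \<open>p \<noteq> 0\<close>, of "w * b i"] p by (auto simp: c_def)
  moreover have c: "p dvd w * b i - c" unfolding c_def by (simp add: mod_eq_dvd_iff[symmetric])
  have "p dvd b j - c * a j" if "j \<in> J" for j
  proof -
    have "b j - c * a j = (w * b i - c) * a j + (w * (a i * b j - a j * b i) - (w * a i - 1) * b j)"
      by (simp add: algebra_simps)
    also have "p dvd \<dots>"
      by (intro dvd_add dvd_diff dvd_mult[OF cross[OF that]] dvd_mult2 w c)
    finally show ?thesis .
  qed
  ultimately show ?thesis using that by blast
qed

text \<open>The pairing \<open>(m, q) \<mapsto> coeff (m q mod p) 1\<close> on \<open>\<K>[t]/(p)\<close> is non-degenerate. Testing with \<open>1\<close> and \<open>t\<close>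
is enough.\<close>

lemma dvd_if_functional_vanishes:
  fixes p m :: "'a::field poly"
  assumes p: "degree p = 2" and 0: "\<And>q. degree q < 2 \<Longrightarrow> coeff ((m * q) mod p) 1 = 0"
  shows "p dvd m"
proof -
  have "p \<noteq> 0" using p by auto
  have "degree (m mod p) < 2" using degree_mod_less[OF \<open>p \<noteq> 0\<close>, of m] p by auto
  moreover have "coeff (m mod p) 1 = 0" using 0[of 1] by simp
  ultimately have "degree (m mod p) = 0"
    by (metis One_nat_def degree_0 leading_coeff_0_iff less_2_cases)
  then obtain k where k: "m mod p = [:k:]" by (metis degree_0_id)
  have "(m * [:0, 1:]) mod p = ((m mod p) * [:0, 1:]) mod p" by (simp only: mod_mult_left_eq)
  also have "\<dots> = [:0, k:] mod p" by (simp add: k)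
  also have "\<dots> = [:0, k:]" using p by (intro mod_poly_less) simp
  finally have "k = 0" using 0[of "[:0, 1:]"] by simp
  then show ?thesis using k by (simp add: mod_eq_0_iff_dvd)
qed

locale quadratic_extension_coordinates = finite_dimensional_vector_space scale Basis
  for scale :: "'a::field \<Rightarrow> 'v::ab_group_add \<Rightarrow> 'v" and Basis +
  fixes p :: "'a poly" and X :: "nat \<Rightarrow> 'v \<Rightarrow> 'a poly"
  assumes p: "degree p = 2" "irreducible p"
    and X_add: "X i (u + v) = X i u + X i v"
    and X_scale: "X i (scale c u) = smult c (X i u)"
    and degree_X: "degree (X i u) < 2"
    and X_inj: "(\<And>i. i < 3 \<Longrightarrow> X i u = X i v) \<Longrightarrow> u = v"
    and X_surj: "(\<And>i. degree (f i) < 2) \<Longrightarrow> \<exists>u. \<forall>i<3. X i u = f i"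
begin

definition cross :: "nat \<Rightarrow> nat \<Rightarrow> 'v \<Rightarrow> 'v \<Rightarrow> 'a poly" where
  "cross i j x y = X i x * X j y - X j x * X i y"

definition det3 :: "'v \<Rightarrow> 'v \<Rightarrow> 'v \<Rightarrow> 'a poly" where
  "det3 x y z = cross 1 2 x y * X 0 z + cross 2 0 x y * X 1 z + cross 0 1 x y * X 2 z"

text \<open>The coefficient of \<open>t\<close> serves as the non-zero \<open>\<K>\<close>-linear functional on \<open>\<K>[t]/(p)\<close>.\<close>

definition form :: "'v \<Rightarrow> 'v \<Rightarrow> 'v \<Rightarrow> 'a" where
  "form x y z = coeff (det3 x y z mod p) 1"

lemma form_add: "form x y (u + v) = form x y u + form x y v"
proof -
  have "det3 x y (u + v) = det3 x y u + det3 x y v"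
    by (simp add: det3_def X_add algebra_simps)
  then show ?thesis by (simp add: form_def poly_mod_add_left)
qed

lemma form_scale: "form x y (scale c u) = c * form x y u"
proof -
  have "det3 x y (scale c u) = smult c (det3 x y u)"
    by (simp add: det3_def X_scale smult_add_right)
  then show ?thesis by (simp add: form_def mod_smult_left)
qed

lemma form_swap: "form y x z = - form x y z" "form x z y = - form x y z"
proof -
  have "det3 y x z = - det3 x y z" "det3 x z y = - det3 x y z"
    by (simp_all add: det3_def cross_def algebra_simps)
  then show "form y x z = - form x y z" "form x z y = - form x y z"
    by (simp_all add: form_def poly_mod_minus_left)
qed

lemma form_same: "form x x z = 0"
  by (simp add: form_def det3_def cross_def mult.commute)

sublocale zero: alternating_zero_relation scale Basis "\<lambda>x y z. form x y z = 0"
proof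
  show "\<exists>s t. (s \<noteq> 0 \<or> t \<noteq> 0) \<and> form x y (scale s u + scale t v) = 0" for x y u v
  proof (cases "form x y u = 0")
    case True
    then show ?thesis by (metis form_add form_scale add_0 mult_zero_left mult_zero_right one_neq_zero)
  next
    case False
    moreover have "form x y (scale (form x y v) u + scale (- form x y u) v) = 0"
      unfolding form_add form_scale by simp
    ultimately show ?thesis by (metis neg_equal_0_iff_equal)
  qed
  show "subspace {z. form x y z = 0}" for x y
    using form_scale[of x y 0 0] by (intro subspaceI) (auto simp: form_add form_scale)
  show "form y x z = 0" if "form x y z = 0" for x y z using that form_swap(1)[of y x z] by simp
  show "form x z y = 0" if "form x y z = 0" for x y z using that form_swap(2)[of x z y] by simp
  show "form x x z = 0" for x z by (rule form_same)
qed

lemma degree_mod_p: "degree (q mod p) < 2"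
proof -
  have "p \<noteq> 0" using p by auto
  then show ?thesis using degree_mod_less[of p q] p by auto
qed

lemma eq_0_if_dvd: "p dvd q \<Longrightarrow> degree q < 2 \<Longrightarrow> q = 0"
  using dvd_imp_degree_le[of p q] p by auto

text \<open>Expanding the determinant along \<open>z\<close> and letting \<open>z\<close> run through the vectors with one non-zero
coordinate isolates each cross product; non-degeneracy of the functional does the rest.\<close>

lemma in_rad_iff: "y \<in> zero.rad x \<longleftrightarrow> p dvd cross 1 2 x y \<and> p dvd cross 2 0 x y \<and> p dvd cross 0 1 x y"
proof
  assume y: "y \<in> zero.rad x"
  have X_single: "\<exists>z. X 0 z = (if k = 0 then q else 0) \<and> X 1 z = (if k = 1 then q else 0) \<and>
      X 2 z = (if k = 2 then q else 0)" if "degree q < 2" for q and k :: nat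
    using X_surj[of "\<lambda>i. if i = k then q else 0"] that by fastforce
  have vanish: "coeff ((m * q) mod p) 1 = 0"
    if "degree q < 2" "(m, k) \<in> {(cross 1 2 x y, 0), (cross 2 0 x y, 1), (cross 0 1 x y, 2)}"
    for m q and k :: nat
  proof -
    obtain z where "X 0 z = (if k = 0 then q else 0)" "X 1 z = (if k = 1 then q else 0)"
      "X 2 z = (if k = 2 then q else 0)" using X_single \<open>degree q < 2\<close> by blast
    then have "det3 x y z = m * q" using that(2) by (auto simp: det3_def)
    moreover have "form x y z = 0" using y by (simp add: zero.rad_def)
    ultimately show ?thesis by (simp add: form_def)
  qed
  show "p dvd cross 1 2 x y \<and> p dvd cross 2 0 x y \<and> p dvd cross 0 1 x y"
    using vanish by (intro conjI dvd_if_functional_vanishes[OF p(1)]) blast+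
next
  assume "p dvd cross 1 2 x y \<and> p dvd cross 2 0 x y \<and> p dvd cross 0 1 x y"
  then have "p dvd det3 x y z" for z unfolding det3_def by (intro dvd_add dvd_mult2) auto
  then have "form x y z = 0" for z by (simp add: form_def)
  then show "y \<in> zero.rad x" by (simp add: zero.rad_def)
qed

lemma in_rad_imp_multiple:
  assumes x: "x \<noteq> 0" and y: "y \<in> zero.rad x"
  obtains c where "degree c < 2" "\<And>i. i < 3 \<Longrightarrow> p dvd X i y - c * X i x"
proof -
  have lt3: "i = 0 \<or> i = 1 \<or> i = 2" if "i < 3" for i :: nat using that by linarith
  have anti: "cross j i x y = - cross i j x y" and self: "cross i i x y = 0" for i j
    by (simp_all add: cross_def)
  have "p dvd cross 1 2 x y" "p dvd cross 2 0 x y" "p dvd cross 0 1 x y"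
    using y in_rad_iff by auto
  moreover have "p dvd cross 2 1 x y" "p dvd cross 0 2 x y" "p dvd cross 1 0 x y"
    using calculation anti[of 1 2] anti[of 2 0] anti[of 0 1] by simp_all
  ultimately have cross: "p dvd cross i j x y" if "i < 3" "j < 3" for i j
    using lt3[OF that(1)] lt3[OF that(2)] self by (elim disjE) simp_all
  have "X i 0 = 0" for i using X_scale[of i 0 0] by simp
  then obtain i where i: "i < 3" "X i x \<noteq> 0" using X_inj[of x 0] x by metis
  obtain c where "degree c < 2" "\<And>j. j \<in> {..<3} \<Longrightarrow> p dvd X j y - c * X j x"
    by (rule proportional_if_cross_products_vanish[OF p, of "\<lambda>j. X j x" i "{..<3}" "\<lambda>j. X j y"])
      (use i degree_X cross in \<open>auto simp: cross_def\<close>)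
  with that show ?thesis by simp
qed

text \<open>The radical of \<open>x\<close> is the line of \<open>x\<close> over \<open>\<K>[t]/(p)\<close>, with \<open>\<K>\<close>-basis \<open>x\<close> and \<open>y = t x\<close>.\<close>

lemma rad_eq_extension_line:
  assumes x: "x \<noteq> 0"
  shows "\<exists>y. y \<notin> span {x} \<and> zero.rad x = span {y, x}"
proof -
  let ?t = "[:0, 1:] :: 'a poly"
  obtain y where y: "X i y = (?t * X i x) mod p" if "i < 3" for i
    using X_surj[of "\<lambda>i. (?t * X i x) mod p"] degree_mod_p by blast
  have y_dvd: "p dvd ?t * X i x - X i y" if "i < 3" for i
    using y[OF that] by (simp add: mod_eq_dvd_iff[symmetric])
  have "y \<notin> span {x}"
  proof
    assume "y \<in> span {x}"
    then obtain k where k: "y = scale k x" by (auto simp: span_singleton)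
    have "X i x = X i 0" if "i < 3" for i
    proof -
      have "?t * X i x - X i y = [:- k, 1:] * X i x" by (simp add: k X_scale)
      with y_dvd[OF that] have "p dvd [:- k, 1:] * X i x" by simp
      then have "p dvd [:- k, 1:] \<or> p dvd X i x"
        using field_poly_irreducible_imp_prime[OF p(2)] prime_elem_dvd_mult_iff by blast
      then have "X i x = 0"
        using eq_0_if_dvd[of "[:- k, 1:]"] eq_0_if_dvd[of "X i x"] degree_X by auto
      then show ?thesis using X_scale[of i 0 0] by simp
    qed
    then show False using X_inj x by blast
  qed
  moreover have "y \<in> zero.rad x"
  proof -
    have "p dvd cross i j x y" if "i < 3" "j < 3" for i j
    proof -
      have "cross i j x y = X j x * (?t * X i x - X i y) - X i x * (?t * X j x - X j y)"
        by (simp add: cross_def algebra_simps)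
      also have "p dvd \<dots>" using that by (intro dvd_diff dvd_mult y_dvd)
      finally show ?thesis .
    qed
    then show ?thesis by (simp add: in_rad_iff)
  qed
  moreover have "v \<in> span {y, x}" if v: "v \<in> zero.rad x" for v
  proof -
    obtain c where c: "degree c < 2" "\<And>i. i < 3 \<Longrightarrow> p dvd X i v - c * X i x"
      using in_rad_imp_multiple[OF x v] by blast
    define c0 c1 where "c0 = coeff c 0" "c1 = coeff c 1"
    have c_eq: "c = [:c0:] + smult c1 ?t"
    proof (rule poly_eqI)
      fix n :: nat
      consider "n = 0" | "n = 1" | "n \<ge> 2" by linarith
      then show "coeff c n = coeff ([:c0:] + smult c1 ?t) n"
        using c(1) by cases (auto simp: c0_c1_def coeff_eq_0 coeff_pCons split: nat.split)
    qed
    let ?w = "scale c0 x + scale c1 y"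
    have "X i v = X i ?w" if i: "i < 3" for i
    proof -
      have "X i v - X i ?w = (X i v - c * X i x) + smult c1 (?t * X i x - X i y)"
        by (simp add: c_eq X_add X_scale algebra_simps smult_diff_right)
      also have "p dvd \<dots>" using c(2) y_dvd i by (intro dvd_add dvd_smult)
      finally have "p dvd X i v - X i ?w" .
      then have "X i v - X i ?w = 0" using degree_X by (intro eq_0_if_dvd degree_diff_less)
      then show ?thesis by simp
    qed
    then have "v = ?w" using X_inj by blast
    then show ?thesis by (auto intro!: span_add span_scale intro: span_base)
  qed
  ultimately show ?thesis
    using zero.self_in_rad[of x] zero.subspace_rad by (metis (no_types, lifting) empty_subsetI insert_subset span_minimal subsetI subset_antisym)
qed

end

theorem (in finite_dimensional_vector_space) spread_if_not_quadratically_closed: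
  assumes dim6: "dim (UNIV::'b set) = 6" and "\<not> quadratically_closed TYPE('a)"
  shows "\<exists>H. grassmann_hyperplane scale 3 H \<and> line_spread scale (upper_radical scale H)"
proof -
  obtain p :: "'a poly" where p: "degree p = 2" "irreducible p"
    using assms(2) by (auto simp: quadratically_closed_def)
  obtain X :: "nat \<Rightarrow> 'b \<Rightarrow> 'a poly" where X:
    "\<And>i u v. X i (u + v) = X i u + X i v" "\<And>i c u. X i (scale c u) = smult c (X i u)"
    "\<And>i u. degree (X i u) < 2" "\<And>u v. (\<And>i. i < 3 \<Longrightarrow> X i u = X i v) \<Longrightarrow> u = v"
    "\<And>f. (\<And>i. degree (f i) < 2) \<Longrightarrow> \<exists>u. \<forall>i<3. X i u = f i"
    using obtain_linear_poly_coordinates[OF dim6] by blast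
  interpret quadratic_extension_coordinates scale Basis p X
    by unfold_locales (use p X in blast)+
  have "\<not> (UNIV::'b set) \<subseteq> span {}" using dim_mono[of UNIV "{}"] dim6 by force
  then obtain x :: 'b where x: "x \<noteq> 0" by auto
  have "dim (zero.rad x) = 2" using rad_eq_extension_line[OF x] dim_pair[OF x] by auto
  then have "zero.rad x \<noteq> UNIV" using dim6 by auto
  then obtain y z where "form x y z \<noteq> 0" unfolding zero.rad_def by blast
  then have "grassmann_hyperplane scale 3 zero.zero_set"
    by (rule zero.grassmann_hyperplane_zero_set)
  moreover have "line_spread scale (upper_radical scale zero.zero_set)"
    using zero.line_spread_upper_radical_iff[OF zero.zero_set_iff] rad_eq_extension_line by blast
  ultimately show ?thesis by blast
qed

section \<open>Upper radicals in dimensions five and six\<close>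

theorem theorem1p4:
  fixes scale :: "'a::field \<Rightarrow> 'v::ab_group_add \<Rightarrow> 'v"
  assumes "vector_space scale"
  shows "(vector_space.dim scale UNIV = 5 \<longrightarrow>
           (\<forall>H. grassmann_hyperplane scale 3 H \<longrightarrow> upper_radical scale H \<noteq> {})) \<and>
         (vector_space.dim scale UNIV = 6 \<longrightarrow>
           ((\<exists>H. grassmann_hyperplane scale 3 H \<and> line_spread scale (upper_radical scale H))
            \<longleftrightarrow> \<not> quadratically_closed TYPE('a)))"
proof -
  interpret vector_space scale by fact
  show ?thesis
  proof (cases "dim UNIV = 0")
    case False
    obtain B where B: "independent B" "UNIV \<subseteq> span B" "card B = dim UNIV"
      using basis_exists[of UNIV] by blast
    then have "finite B" using False by (metis card.infinite)
    with B interpret finite_dimensional_vector_space scale B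
      by unfold_locales auto
    show ?thesis
    proof (intro conjI impI allI)
      fix H assume dim5: "dim UNIV = 5" and H: "grassmann_hyperplane scale 3 H"
      interpret alternating_zero_relation scale B "triple_in H"
        by (rule hyperplane_zero_relation[OF H])
      obtain x y where xy: "x \<noteq> 0" "y \<notin> span {x}" "\<forall>z. triple_in H x y z"
        using exists_radical_pair_dim5[OF dim5] by blast
      then have "y \<in> rad x" by (simp add: rad_def)
      then show "upper_radical scale H \<noteq> {}"
        using upper_radical_iff[OF triple_in_iff xy(1,2)] by blast
    next
      assume dim6: "dim UNIV = 6"
      have "\<not> quadratically_closed TYPE('a)"
        if H: "grassmann_hyperplane scale 3 H" and S: "line_spread scale (upper_radical scale H)" for H
      proof -
        interpret alternating_zero_relation scale B "triple_in H"
          by (rule hyperplane_zero_relation[OF H])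
        interpret spread_zero_relation scale B "triple_in H"
          using line_spread_upper_radical_iff[OF triple_in_iff] S by unfold_locales blast
        show ?thesis using not_quadratically_closed_if_spread[OF dim6] .
      qed
      then show "(\<exists>H. grassmann_hyperplane scale 3 H \<and> line_spread scale (upper_radical scale H))
            \<longleftrightarrow> \<not> quadratically_closed TYPE('a)"
        using spread_if_not_quadratically_closed[OF dim6] by blast
    qed
  qed simp
qed

end
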